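(* Let $k\ge 2$ be an integer, let $f(x)\in\mathbb{Z}[x]$ be a nonconstant polynomial and let $c$ be an integer. Then the function $n\mapsto \mathcal{N}_{k,f,c}(n)$ is multiplicative, and for every positive integer $n$, $$\mathcal{N}_{k,f,c}(n)=n^{k-1}\prod_{p\mid n}\Big(1-\frac{\mathcal{M}_{k,f,c}(p)}{p^{k-1}}\Big),$$ where the product runs over the distinct prime divisors $p$ of $n$.
   Context: For a positive integer $n$, $\mathbb{Z}_n=\{0,1,\dots,n-1\}$ denotes the ring of residue classes modulo $n$. For $f(x)\in\mathbb{Z}[x]$, an integer $a$ is called an $f$-exunit in $\mathbb{Z}_n$ if $\gcd(f(a),n)=1$, and $E_f(n)=\{a\in\mathbb{Z}_n:\gcd(f(a),n)=1\}$. Define $$\mathcal{N}_{k,f,c}(n)=\#\{(x_1,\dots,x_k)\in E_f(n)^k: x_1+\cdots+x_k\equiv c\pmod n\}.$$ For a prime $p$, define $$\mathcal{M}_{k,f,c}(p)=\#\Big\{(x_1,\dots,x_{k-1})\in\mathbb{Z}_p^{k-1}: f(x_1)\cdots f(x_{k-1})\,f\Big(c-\sum_{i=1}^{k-1}x_i\Big)\equiv 0\pmod p\Big\}.$$ *)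

theory Defs
  imports
    "HOL-Library.FuncSet"
    "HOL-Computational_Algebra.Computational_Algebra"
    "HOL-Number_Theory.Number_Theory"
begin

text \<open>Residue classes modulo \<open>n\<close> are represented by the integers \<open>0, \<dots>, n - 1\<close>.\<close>

definition residue_classes :: "nat \<Rightarrow> int set" where
  "residue_classes n = {0..<int n}"

definition exunit :: "int poly \<Rightarrow> nat \<Rightarrow> int \<Rightarrow> bool" where
  "exunit f n a \<longleftrightarrow> gcd (poly f a) (int n) = 1"

definition exunits :: "int poly \<Rightarrow> nat \<Rightarrow> int set" where
  "exunits f n = {a \<in> residue_classes n. exunit f n a}"

text \<open>
  A \<open>k\<close>-tuple with entries in \<open>S\<close> is an extensional function in \<open>{1..k} \<rightarrow>\<^sub>E S\<close>; since such
  functions are fixed to \<open>undefined\<close> outside \<open>{1..k}\<close>, each tuple is counted exactly once.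
\<close>

definition num_reps :: "nat \<Rightarrow> int poly \<Rightarrow> int \<Rightarrow> nat \<Rightarrow> nat" where
  "num_reps k f c n =
     card {x \<in> {1..k} \<rightarrow>\<^sub>E exunits f n. [(\<Sum>i=1..k. x i) = c] (mod int n)}"

definition num_zeros :: "nat \<Rightarrow> int poly \<Rightarrow> int \<Rightarrow> nat \<Rightarrow> nat" where
  "num_zeros k f c p =
     card {x \<in> {1..k-1} \<rightarrow>\<^sub>E residue_classes p.
       [(\<Prod>i=1..k-1. poly f (x i)) * poly f (c - (\<Sum>i=1..k-1. x i)) = 0] (mod int p)}"

text \<open>Arithmetic functions live on the positive integers, so the value at \<open>0\<close> is unconstrained.\<close>

definition multiplicative :: "(nat \<Rightarrow> 'a::comm_semiring_1) \<Rightarrow> bool" where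
  "multiplicative F \<longleftrightarrow>
     F 1 = 1 \<and> (\<forall>m n. m > 0 \<longrightarrow> n > 0 \<longrightarrow> coprime m n \<longrightarrow> F (m * n) = F m * F n)"

end

theory Submission
  imports Defs
begin

text \<open>
  The congruence condition determines the last summand, so $\mathcal{N}(n)$ counts the
  $(k-1)$-tuples at which $f(x_1) \cdots f(x_{k-1}) f(c - x_1 - \cdots - x_{k-1})$ is a unit
  modulo $n$. By the Chinese remainder theorem this count is multiplicative. Being a unit modulo
  $p^e$ depends only on the tuple modulo $p$, so each of the $p^{k-1} - \mathcal{M}(p)$ good tuples
  modulo $p$ has $p^{(e-1)(k-1)}$ lifts modulo $p^e$.
\<close>

section \<open>Tuples of residues and reduction of their entries\<close>

definition tuples :: "nat \<Rightarrow> nat \<Rightarrow> (nat \<Rightarrow> int) set" where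
  "tuples K n = {1..K} \<rightarrow>\<^sub>E residue_classes n"

definition reduce :: "nat \<Rightarrow> nat \<Rightarrow> (nat \<Rightarrow> int) \<Rightarrow> nat \<Rightarrow> int" where
  "reduce K n x = (\<lambda>i\<in>{1..K}. x i mod int n)"

text \<open>With \<open>K = k - 1\<close>, the last factor is the value of \<open>f\<close> at the
  entry that closes the tuple to sum \<open>c\<close>. That entry is left unreduced, so the
  expression makes sense for every modulus at once.\<close>

definition closed_product :: "int poly \<Rightarrow> int \<Rightarrow> nat \<Rightarrow> (nat \<Rightarrow> int) \<Rightarrow> int" where
  "closed_product f c K x = (\<Prod>i=1..K. poly f (x i)) * poly f (c - (\<Sum>i=1..K. x i))"

definition unit_tuples :: "nat \<Rightarrow> int poly \<Rightarrow> int \<Rightarrow> nat \<Rightarrow> (nat \<Rightarrow> int) set" where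
  "unit_tuples K f c n = {x \<in> tuples K n. coprime (closed_product f c K x) (int n)}"

lemma cong_poly:
  fixes f :: "int poly"
  assumes "[a = b] (mod m)"
  shows "[poly f a = poly f b] (mod m)"
proof (induction f)
  case (pCons d f)
  then show ?case
    using assms by (auto intro!: cong_add cong_mult)
qed simp

lemma finite_tuples [simp]: "finite (tuples K n)"
  by (simp add: tuples_def residue_classes_def finite_PiE)

lemma card_tuples [simp]: "card (tuples K n) = n ^ K"
  by (simp add: tuples_def residue_classes_def card_PiE)

lemma tuples_bounds:
  assumes "x \<in> tuples K n" "i \<in> {1..K}"
  shows "0 \<le> x i" "x i < int n"
  using PiE_mem[OF assms[unfolded tuples_def]] by (auto simp: residue_classes_def)

lemma tuples_eqI:
  assumes "x \<in> tuples K n" "y \<in> tuples K n"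
    and "\<And>i. i \<in> {1..K} \<Longrightarrow> [x i = y i] (mod int n)"
  shows "x = y"
proof (rule PiE_ext)
  show "x \<in> {1..K} \<rightarrow>\<^sub>E residue_classes n" "y \<in> {1..K} \<rightarrow>\<^sub>E residue_classes n"
    using assms(1,2) by (simp_all add: tuples_def)
  show "x i = y i" if "i \<in> {1..K}" for i
    using assms(3)[OF that] tuples_bounds[OF assms(1) that] tuples_bounds[OF assms(2) that]
    by (simp add: cong_def)
qed

lemma reduce_in_tuples: "n > 0 \<Longrightarrow> reduce K n x \<in> tuples K n"
  by (auto simp: reduce_def tuples_def residue_classes_def)

lemma cong_reduce: "i \<in> {1..K} \<Longrightarrow> [reduce K n x i = x i] (mod int n)"
  by (simp add: reduce_def)

lemma cong_closed_product:
  assumes "\<And>i. i \<in> {1..K} \<Longrightarrow> [x i = y i] (mod m)"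
  shows "[closed_product f c K x = closed_product f c K y] (mod m)"
  unfolding closed_product_def
  by (intro cong_mult cong_prod cong_poly cong_diff cong_sum cong_refl assms)

lemma cong_closed_product_reduce:
  "[closed_product f c K (reduce K n x) = closed_product f c K x] (mod int n)"
  by (intro cong_closed_product cong_reduce)

section \<open>Coprime moduli\<close>

text \<open>Only the uniqueness half of the Chinese remainder theorem is argued, entry by entry.
  Surjectivity follows by counting, since both sides have \<open>(m * n) ^ K\<close>
  elements.\<close>

lemma bij_betw_reduce_coprime:
  assumes "m > 0" "n > 0" "coprime m n"
  shows "bij_betw (\<lambda>x. (reduce K m x, reduce K n x)) (tuples K (m * n)) (tuples K m \<times> tuples K n)"
proof -
  let ?h = "\<lambda>x. (reduce K m x, reduce K n x)"
  have inj: "inj_on ?h (tuples K (m * n))"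
  proof (rule inj_onI)
    fix x y
    assume x: "x \<in> tuples K (m * n)" and y: "y \<in> tuples K (m * n)" and eq: "?h x = ?h y"
    show "x = y"
    proof (rule tuples_eqI[OF x y])
      fix i assume i: "i \<in> {1..K}"
      have "[x i = y i] (mod int m)" "[x i = y i] (mod int n)"
        using eq cong_reduce[OF i, of m x] cong_reduce[OF i, of m y]
          cong_reduce[OF i, of n x] cong_reduce[OF i, of n y]
        by (simp_all add: cong_def)
      then show "[x i = y i] (mod int (m * n))"
        using assms(3) by (simp add: coprime_cong_mult)
    qed
  qed
  have sub: "?h ` tuples K (m * n) \<subseteq> tuples K m \<times> tuples K n"
    using assms by (auto intro: reduce_in_tuples)
  have "?h ` tuples K (m * n) = tuples K m \<times> tuples K n"
    by (rule card_subset_eq[OF _ sub])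
      (simp_all add: card_image[OF inj] card_cartesian_product power_mult_distrib)
  with inj show ?thesis by (simp add: bij_betw_def)
qed

text \<open>Reduction preserves \<open>closed_product\<close> modulo \<open>m\<close> and modulo
  \<open>n\<close>, and coprimality to \<open>m * n\<close> is coprimality to both, so the Chinese
  remainder bijection restricts to unit tuples.\<close>

lemma card_unit_tuples_mult:
  assumes "m > 0" "n > 0" "coprime m n"
  shows "card (unit_tuples K f c (m * n)) = card (unit_tuples K f c m) * card (unit_tuples K f c n)"
proof -
  let ?h = "\<lambda>x. (reduce K m x, reduce K n x)"
  note bij = bij_betw_reduce_coprime[OF assms, of K]
  have iff: "x \<in> unit_tuples K f c (m * n) \<longleftrightarrow> ?h x \<in> unit_tuples K f c m \<times> unit_tuples K f c n"
    if "x \<in> tuples K (m * n)" for x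
    using that assms(1,2) cong_closed_product_reduce[of f c K m x]
      cong_closed_product_reduce[of f c K n x]
    by (auto simp: unit_tuples_def reduce_in_tuples coprime_mult_right_iff
        dest: cong_imp_coprime cong_imp_coprime[OF cong_sym])
  have "bij_betw ?h (unit_tuples K f c (m * n)) (unit_tuples K f c m \<times> unit_tuples K f c n)"
  proof (rule bij_betw_subset[OF bij])
    show "unit_tuples K f c (m * n) \<subseteq> tuples K (m * n)"
      by (auto simp: unit_tuples_def)
    show "?h ` unit_tuples K f c (m * n) = unit_tuples K f c m \<times> unit_tuples K f c n"
    proof (intro equalityI subsetI)
      fix z assume z: "z \<in> unit_tuples K f c m \<times> unit_tuples K f c n"
      then have "z \<in> tuples K m \<times> tuples K n"
        by (auto simp: unit_tuples_def)
      then obtain x where "x \<in> tuples K (m * n)" "z = ?h x"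
        using bij by (auto simp: bij_betw_def)
      with z show "z \<in> ?h ` unit_tuples K f c (m * n)"
        using iff by blast
    qed (use iff in \<open>auto simp: unit_tuples_def\<close>)
  qed
  from bij_betw_same_card[OF this] show ?thesis
    by (simp add: card_cartesian_product)
qed

section \<open>Lifting from a modulus to its powers\<close>

text \<open>Each entry is written in base \<open>m\<close> with low digit \<open>y i\<close> and
  high part \<open>z i\<close>. Reduction modulo \<open>m\<close> recovers \<open>y\<close>,
  cancelling \<open>m\<close> then recovers \<open>z\<close>, and equal cardinalities give
  surjectivity.\<close>

lemma bij_betw_digits:
  assumes "m > 0" "n > 0"
  shows "bij_betw (\<lambda>(y, z). \<lambda>i\<in>{1..K}. y i + int m * z i)
    (tuples K m \<times> tuples K n) (tuples K (m * n))"
proof -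
  let ?h = "\<lambda>(y, z). \<lambda>i\<in>{1..K}. y i + int m * z i :: int"
  have inj: "inj_on ?h (tuples K m \<times> tuples K n)"
  proof (rule inj_onI, clarify)
    fix y z y' z'
    assume y: "y \<in> tuples K m" "y' \<in> tuples K m" and z: "z \<in> tuples K n" "z' \<in> tuples K n"
      and eq: "(\<lambda>i\<in>{1..K}. y i + int m * z i) = (\<lambda>i\<in>{1..K}. y' i + int m * z' i)"
    have eqi: "y i + int m * z i = y' i + int m * z' i" if "i \<in> {1..K}" for i
      using fun_cong[OF eq, of i] that by simp
    have yy: "y = y'"
    proof (rule tuples_eqI[OF y])
      fix i assume "i \<in> {1..K}"
      then show "[y i = y' i] (mod int m)"
        using arg_cong[OF eqi, of i "\<lambda>t. t mod int m"] by (simp add: cong_def)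
    qed
    moreover have "z = z'"
      by (rule tuples_eqI[OF z]) (use eqi yy assms in simp)
    ultimately show "y = y' \<and> z = z'" by simp
  qed
  have sub: "?h ` (tuples K m \<times> tuples K n) \<subseteq> tuples K (m * n)"
  proof clarify
    fix y z
    assume y: "y \<in> tuples K m" and z: "z \<in> tuples K n"
    have "0 \<le> y i + int m * z i \<and> y i + int m * z i < int m * int n" if i: "i \<in> {1..K}" for i
    proof -
      have "y i + int m * z i < int m * (z i + 1)"
        using tuples_bounds[OF y i] by (simp add: algebra_simps)
      also have "\<dots> \<le> int m * int n"
        using tuples_bounds[OF z i] by (intro mult_left_mono) auto
      finally show ?thesis
        using tuples_bounds[OF y i] tuples_bounds[OF z i] by simp
    qed
    then show "(\<lambda>i\<in>{1..K}. y i + int m * z i) \<in> tuples K (m * n)"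
      by (auto simp: tuples_def residue_classes_def)
  qed
  have "?h ` (tuples K m \<times> tuples K n) = tuples K (m * n)"
    by (rule card_subset_eq[OF _ sub], simp, subst card_image[OF inj])
      (simp add: card_cartesian_product power_mult_distrib)
  with inj show ?thesis by (simp add: bij_betw_def)
qed

text \<open>Whether a lift is a unit tuple depends only on its low digits \<open>y\<close>, and the
  high part \<open>z\<close> ranges freely over \<open>(p ^ e) ^ K\<close> tuples. The exponent is
  \<open>Suc e\<close> because coprimality to \<open>p ^ 0\<close> says nothing about
  \<open>p\<close>.\<close>

lemma card_unit_tuples_power:
  assumes "p > 0"
  shows "card (unit_tuples K f c (p ^ Suc e)) = (p ^ e) ^ K * card (unit_tuples K f c p)"
proof -
  let ?h = "\<lambda>(y, z). \<lambda>i\<in>{1..K}. y i + int p * z i :: int"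
  have "p ^ e > 0" using assms by simp
  \<comment> \<open>Folding turns the modulus \<open>p * p ^ e\<close> into
    \<open>p ^ Suc e\<close>.\<close>
  note bij = bij_betw_digits[OF assms this, of K, folded power_Suc]
  have iff: "?h w \<in> unit_tuples K f c (p ^ Suc e) \<longleftrightarrow> w \<in> unit_tuples K f c p \<times> tuples K (p ^ e)"
    if w: "w \<in> tuples K p \<times> tuples K (p ^ e)" for w
  proof -
    obtain y z where yz: "w = (y, z)" "y \<in> tuples K p" "z \<in> tuples K (p ^ e)"
      using w by auto
    have "?h w \<in> tuples K (p ^ Suc e)"
      using bij w by (auto simp: bij_betw_def)
    moreover have "[closed_product f c K (?h w) = closed_product f c K y] (mod int p)"
      by (rule cong_closed_product) (simp add: yz cong_def)
    then have "coprime (closed_product f c K (?h w)) (int p) \<longleftrightarrow>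
        coprime (closed_product f c K y) (int p)"
      using cong_imp_coprime cong_sym by blast
    moreover have "coprime a (int (p ^ Suc e)) \<longleftrightarrow> coprime a (int p)" for a
      by (simp add: coprime_power_right_iff del: power_Suc)
    ultimately show ?thesis
      using yz by (simp add: unit_tuples_def del: power_Suc of_nat_power)
  qed
  have "bij_betw ?h (unit_tuples K f c p \<times> tuples K (p ^ e)) (unit_tuples K f c (p ^ Suc e))"
  proof (rule bij_betw_subset[OF bij])
    show "unit_tuples K f c p \<times> tuples K (p ^ e) \<subseteq> tuples K p \<times> tuples K (p ^ e)"
      by (auto simp: unit_tuples_def)
    show "?h ` (unit_tuples K f c p \<times> tuples K (p ^ e)) = unit_tuples K f c (p ^ Suc e)"
    proof (intro equalityI subsetI)
      fix x assume x: "x \<in> unit_tuples K f c (p ^ Suc e)"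
      then have "x \<in> tuples K (p ^ Suc e)"
        by (simp add: unit_tuples_def)
      then obtain w where w: "w \<in> tuples K p \<times> tuples K (p ^ e)" "x = ?h w"
        using bij unfolding bij_betw_def by blast
      with x show "x \<in> ?h ` (unit_tuples K f c p \<times> tuples K (p ^ e))"
        using iff[OF w(1)] by blast
    next
      fix x assume "x \<in> ?h ` (unit_tuples K f c p \<times> tuples K (p ^ e))"
      then obtain w where w: "w \<in> unit_tuples K f c p \<times> tuples K (p ^ e)" "x = ?h w"
        by blast
      then have "w \<in> tuples K p \<times> tuples K (p ^ e)"
        by (auto simp: unit_tuples_def)
      with w show "x \<in> unit_tuples K f c (p ^ Suc e)"
        using iff by blast
    qed
  qed
  from bij_betw_same_card[OF this] show ?thesis
    by (simp add: card_cartesian_product mult.commute del: power_Suc)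
qed

section \<open>The count at a prime\<close>

text \<open>Modulo a prime, an integer is either zero or a unit, so the tuples counted by
  \<open>num_zeros\<close> are exactly those outside \<open>unit_tuples\<close>. The additive form
  avoids truncated subtraction.\<close>

lemma card_unit_tuples_prime:
  assumes "prime p"
  shows "card (unit_tuples K f c p) + num_zeros (Suc K) f c p = p ^ K"
proof -
  have "[a = 0] (mod int p) \<longleftrightarrow> \<not> coprime a (int p)" for a
    using assms prime_imp_coprime[of "int p" a] not_prime_unit
    by (auto simp: cong_0_iff coprime_commute coprime_absorb_left)
  then have "{x \<in> {1..Suc K - 1} \<rightarrow>\<^sub>E residue_classes p.
      [(\<Prod>i=1..Suc K - 1. poly f (x i)) * poly f (c - (\<Sum>i=1..Suc K - 1. x i)) = 0]
        (mod int p)} = tuples K p - unit_tuples K f c p"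
    by (auto simp: tuples_def unit_tuples_def closed_product_def)
  then have "num_zeros (Suc K) f c p = card (tuples K p - unit_tuples K f c p)"
    by (simp only: num_zeros_def)
  also have "\<dots> = p ^ K - card (unit_tuples K f c p)"
    by (subst card_Diff_subset) (auto simp: unit_tuples_def intro: finite_subset[OF _ finite_tuples])
  finally show ?thesis
    \<comment> \<open>The inclusion in \<open>tuples K p\<close> bounds the subtracted cardinality
      by \<open>p ^ K\<close>, so nothing is truncated.\<close>
    using card_mono[OF finite_tuples, of "unit_tuples K f c p" K p]
    by (auto simp: unit_tuples_def)
qed

section \<open>Eliminating the last coordinate\<close>

lemma coprime_prod_left_iff:
  "finite A \<Longrightarrow> coprime (\<Prod>i\<in>A. g i) b \<longleftrightarrow> (\<forall>i\<in>A. coprime (g i) b)"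
  for b :: "'a::semiring_gcd"
  by (induction A rule: finite_induct) (simp_all add: coprime_mult_left_iff)

text \<open>Forgetting the last entry (\<open>?r\<close>) is inverted by restoring it as the residue
  of \<open>c\<close> minus the other entries (\<open>?s\<close>).\<close>

lemma num_reps_eq_card_unit_tuples:
  assumes "n > 0"
  shows "num_reps (Suc K) f c n = card (unit_tuples K f c n)"
proof -
  let ?R = "{x \<in> {1..Suc K} \<rightarrow>\<^sub>E exunits f n. [(\<Sum>i=1..Suc K. x i) = c] (mod int n)}"
  let ?r = "\<lambda>x. restrict x {1..K} :: nat \<Rightarrow> int"
  let ?s = "\<lambda>x. x(Suc K := (c - (\<Sum>i=1..K. x i)) mod int n)"
  \<comment> \<open>A product is coprime to \<open>n\<close> iff every factor is: the first
    \<open>K\<close> factors make the entries exunits, the last one concerns the forgotten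
    entry.\<close>
  have unit_tuples_iff: "x \<in> unit_tuples K f c n \<longleftrightarrow>
      x \<in> {1..K} \<rightarrow>\<^sub>E exunits f n \<and> coprime (poly f (c - (\<Sum>i=1..K. x i))) (int n)" for x
    by (auto simp: unit_tuples_def tuples_def exunits_def exunit_def closed_product_def
        PiE_iff coprime_iff_gcd_eq_1[symmetric] coprime_mult_left_iff coprime_prod_left_iff)
  have last: "x (Suc K) = (c - (\<Sum>i=1..K. x i)) mod int n" if "x \<in> ?R" for x
  proof -
    have "x (Suc K) \<in> residue_classes n"
      using that by (auto simp: exunits_def)
    moreover have "[x (Suc K) = c - (\<Sum>i=1..K. x i)] (mod int n)"
      using that by (simp add: cong_iff_dvd_diff algebra_simps)
    ultimately show ?thesis
      by (simp add: residue_classes_def cong_def)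
  qed
  \<comment> \<open>Bridges the restored entry, which is reduced modulo \<open>n\<close>, and the
    unreduced argument in \<open>closed_product\<close>.\<close>
  have coprime_mod: "coprime (poly f (a mod int n)) (int n) \<longleftrightarrow> coprime (poly f a) (int n)" for a
    using cong_poly[of "a mod int n" a "int n" f] cong_imp_coprime cong_sym
    by (metis cong_mod_left cong_refl)
  have "bij_betw ?r ?R (unit_tuples K f c n)"
  proof (rule bij_betw_byWitness[where f' = ?s])
    show "\<forall>x\<in>?R. ?s (?r x) = x"
    proof (intro ballI ext)
      fix x i assume x: "x \<in> ?R"
      then have "x \<in> extensional {1..Suc K}" by (auto simp: PiE_def)
      then show "?s (?r x) i = x i"
        using last[OF x] by (auto simp: extensional_def)
    qed
    show "\<forall>x\<in>unit_tuples K f c n. ?r (?s x) = x"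
    proof (intro ballI ext)
      fix x i assume x: "x \<in> unit_tuples K f c n"
      then have "x \<in> extensional {1..K}" by (auto simp: unit_tuples_iff PiE_def)
      then show "?r (?s x) i = x i"
        by (auto simp: extensional_def)
    qed
    show "?r ` ?R \<subseteq> unit_tuples K f c n"
    proof clarify
      fix x
      assume x: "x \<in> {1..Suc K} \<rightarrow>\<^sub>E exunits f n" "[(\<Sum>i=1..Suc K. x i) = c] (mod int n)"
      then have "x (Suc K) \<in> exunits f n" by auto
      moreover have "x (Suc K) = (c - (\<Sum>i=1..K. x i)) mod int n"
        using x last by blast
      ultimately have "coprime (poly f (c - (\<Sum>i=1..K. x i))) (int n)"
        by (simp add: exunits_def exunit_def coprime_iff_gcd_eq_1[symmetric] coprime_mod)
      moreover have "?r x \<in> {1..K} \<rightarrow>\<^sub>E exunits f n"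
        using x(1) by (auto simp: PiE_iff)
      ultimately show "?r x \<in> unit_tuples K f c n"
        by (simp add: unit_tuples_iff)
    qed
    show "?s ` unit_tuples K f c n \<subseteq> ?R"
    proof (intro image_subsetI)
      fix x assume x: "x \<in> unit_tuples K f c n"
      have "(c - (\<Sum>i=1..K. x i)) mod int n \<in> exunits f n"
        using x assms by (simp add: exunits_def exunit_def residue_classes_def
            coprime_iff_gcd_eq_1[symmetric] coprime_mod unit_tuples_iff)
      then have "?s x \<in> {1..Suc K} \<rightarrow>\<^sub>E exunits f n"
        using x by (auto simp: unit_tuples_iff PiE_iff extensional_def)
      \<comment> \<open>The update at \<open>Suc K\<close> lies outside the range of this
        sum.\<close>
      moreover have "(\<Sum>i=1..K. ?s x i) = (\<Sum>i=1..K. x i)"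
        by (rule sum.cong) auto
      then have "[(\<Sum>i=1..Suc K. ?s x i) = c] (mod int n)"
        by (simp add: cong_def mod_add_right_eq)
      ultimately show "?s x \<in> ?R" by simp
    qed
  qed
  then show ?thesis
    unfolding num_reps_def by (rule bij_betw_same_card)
qed

lemma card_unit_tuples_1: "card (unit_tuples K f c 1) = 1"
proof -
  have "unit_tuples K f c 1 = tuples K 1"
    by (simp add: unit_tuples_def)
  then show ?thesis
    using card_tuples[of K 1] by simp
qed

section \<open>The product formula\<close>

text \<open>Strong induction on \<open>n\<close> that splits off the full power of one prime divisor
  \<open>p\<close>. The cofactor \<open>m\<close> is prime to \<open>p\<close>, so the count factors
  and \<open>p\<close> contributes exactly one new factor to the product.\<close>

lemma card_unit_tuples_eq_prod:
  assumes "n > 0"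
  shows "real (card (unit_tuples K f c n)) =
    real n ^ K * (\<Prod>p\<in>prime_factors n. 1 - real (num_zeros (Suc K) f c p) / real p ^ K)"
  using assms
proof (induction n rule: less_induct)
  case (less n)
  let ?g = "\<lambda>p. 1 - real (num_zeros (Suc K) f c p) / real p ^ K"
  show ?case
  proof (cases "n = 1")
    case True
    then show ?thesis using card_unit_tuples_1 by simp
  next
    case False
    then obtain p where p: "prime p" "p dvd n"
      using prime_factor_nat by blast
    obtain m where m: "n = p ^ multiplicity p n * m" "\<not> p dvd m"
      using multiplicity_decompose'[of n p] less.prems not_prime_unit p(1) by blast
    \<comment> \<open>Multiplicity zero would give \<open>n = m\<close>, although \<open>p\<close>
      divides \<open>n\<close> and not \<open>m\<close>.\<close>
    obtain e where e: "multiplicity p n = Suc e"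
      using p(2) m by (cases "multiplicity p n") auto
    have n: "n = p ^ Suc e * m" using m(1) e by simp
    have "p > 1" "m > 0"
      using p n less.prems prime_gt_1_nat by auto
    then have "m < n"
      using n one_less_power[of p "Suc e"] by simp
    have cop: "coprime (p ^ Suc e) m"
      using p(1) m(2) by (simp add: prime_imp_coprime del: power_Suc)
    have pf: "prime_factors n = insert p (prime_factors m)"
      using n p(1) \<open>m > 0\<close> \<open>p > 1\<close>
      by (simp add: prime_factors_product prime_factorization_prime_power del: power_Suc)
    have "real (card (unit_tuples K f c p)) = real p ^ K - real (num_zeros (Suc K) f c p)"
      using card_unit_tuples_prime[OF p(1), of K f c]
      by (metis add_diff_cancel_right' of_nat_add of_nat_power)
    also have "\<dots> = real p ^ K * ?g p"
      using \<open>p > 1\<close> by (simp add: field_simps)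
    \<comment> \<open>The \<open>(p ^ e) ^ K\<close> lifts combine with \<open>p ^ K\<close> to
      \<open>(p ^ Suc e) ^ K\<close>, leaving the local factor independent of
      \<open>e\<close>.\<close>
    finally have "real (card (unit_tuples K f c (p ^ Suc e))) = real (p ^ Suc e) ^ K * ?g p"
      using \<open>p > 1\<close> by (subst card_unit_tuples_power) (simp_all add: power_mult_distrib)
    moreover have "card (unit_tuples K f c n) =
        card (unit_tuples K f c (p ^ Suc e)) * card (unit_tuples K f c m)"
      using card_unit_tuples_mult[OF _ \<open>m > 0\<close> cop] \<open>p > 1\<close> n by simp
    moreover have "(\<Prod>p\<in>prime_factors n. ?g p) = ?g p * (\<Prod>p\<in>prime_factors m. ?g p)"
      unfolding pf using m(2) by (intro prod.insert) auto
    ultimately show ?thesis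
      using less.IH[OF \<open>m < n\<close> \<open>m > 0\<close>] n by (simp add: power_mult_distrib)
  qed
qed

theorem theorem1p1:
  fixes k :: nat and f :: "int poly" and c :: int
  assumes "k \<ge> 2" and "degree f > 0"
  shows "multiplicative (num_reps k f c) \<and>
    (\<forall>n>0. real (num_reps k f c n) =
       real n ^ (k - 1) *
       (\<Prod>p\<in>prime_factors n. 1 - real (num_zeros k f c p) / real p ^ (k - 1)))"
proof -
  \<comment> \<open>\<open>K\<close> is the number of coordinates left free by the
    congruence.\<close>
  obtain K where k: "k = Suc K" using assms(1) by (cases k) auto
  show ?thesis
    unfolding k multiplicative_def
    using card_unit_tuples_1 card_unit_tuples_mult card_unit_tuples_eq_prod
    by (simp add: num_reps_eq_card_unit_tuples)
qed

end
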